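(* Let $k$ be a field of characteristic zero, $X$ a partitioned alphabet, and $H$ a standard generic bialgebra in $\mathbf{Gen}_X$ with product $\pi$ and coproduct $\Delta$. For every commutative $k$-algebra $B$, the set $G_H(B)$ of $B$-valued characters on $H$ is equipped with a group structure by the convolution product $\phi\ast\phi'=m_B\circ(\phi\otimes\phi')\circ\Delta$ (where $m_B$ is the product of $B$ and $H\hat\otimes H\subset H\otimes H$); this defines a functor $G_H$ from commutative $k$-algebras to groups.
   Context: Let $X$ be a finite or countable alphabet partitioned into subsets, $X=\coprod_{i\in I}X_i$. A word over $X$ (possibly empty) is generic if it contains at most one letter in each $X_i$; a tensor product $t$ of words is generic if its words contain overall at most one letter in each $X_i$. The underlying word $u(t)$ is the concatenation of the components of $t$. Two generic tensor products $w,w'$ are in generic position if $w\otimes w'$ is generic; two linear combinations $\sum\lambda_w w$, $\sum\lambda_{w'}w'$ are in generic position if all pairs $(w,w')$ are. $\mathbf{Gen}_X$ is the smallest linear subcategory of the category of $k$-vector spaces (Hom-sets are $k$-vector spaces) containing the null space and the one-dimensional spaces $V_t$ generated by generic tensor products of words $t$, closed under direct sums (multiple copies of the $V_t$ are allowed), and such that Hom-sets contain: the maps $V_t\to V_{t'}$, $t\mapsto t'$, when $u(t)=u(t')$; the maps induced by substitutions of letters inside the blocks $X_i$; the maps obtained by erasing letters in the tensor products; and the symmetry maps $V_{t\otimes t'}\to V_{t'\otimes t}$. It is a symmetric monoidal category for the generic tensor product $\hat\otimes$: $V_t\hat\otimes V_{t'}=V_{t\otimes t'}$ if $t\otimes t'$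 is generic and $0$ otherwise, extended to direct sums by distributivity. There is a canonical embedding $A\hat\otimes B\hookrightarrow A\otimes B$. Generic algebras, coalgebras, bialgebras, etc., are algebras, coalgebras, bialgebras, etc., in $(\mathbf{Gen}_X,\hat\otimes)$. A generic bialgebra $H$ with product $\pi$ and coproduct $\Delta$ is standard if $H=\bigoplus_{n\ge0}H_n$, where $H_0=V_\emptyset$ is identified with $k$ and $\emptyset$ behaves as a unit/counit for the product and the coproduct; the coproduct is graded ($\Delta(H_n)\subset\bigoplus_{p+q=n}H_p\hat\otimes H_q$); and for all $p,q>0$, $\pi(H_p\hat\otimes H_q)\subset\bigoplus_{0<n\le p+q}H_n$. A $B$-valued character on $H$ is a linear map $\phi:H\to B$ with $\phi(\emptyset)=1$ and $\phi(\pi(h_1\hat\otimes h_2))=\phi(h_1)\phi(h_2)$ for all $h_1,h_2\in H$ in generic position. *)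

theory Defs
  imports
    Complex_Main
    "HOL-Algebra.Group"
    "HOL-Library.Poly_Mapping"
    "HOL-Library.Disjoint_Sets"
    "HOL-Library.Countable_Set"
    "HOL-Library.FuncSet"
begin

section \<open>Generic words and tensor products of words\<close>

text \<open>
  A partitioned alphabet is a countable set \<open>X\<close> with \<open>partition_on X P\<close>; the elements of \<open>P\<close>
  are the blocks \<open>X\<^sub>i\<close>. As \<open>X = \<Union>P\<close>, the definitions below only mention \<open>P\<close>.
  A tensor product of words \<open>w\<^sub>1 \<otimes> \<dots> \<otimes> w\<^sub>n\<close> (\<open>n \<ge> 1\<close>) is the list \<open>[w\<^sub>1, \<dots>, w\<^sub>n]\<close>; its underlying
  word is \<open>concat [w\<^sub>1, \<dots>, w\<^sub>n]\<close>, the tensor product of two of them is \<open>@\<close>, and the empty word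
  \<open>\<emptyset>\<close>, as a tensor product with one factor, is \<open>[[]]\<close>.
\<close>

definition generic_word :: "'x set set \<Rightarrow> 'x list \<Rightarrow> bool" where
  "generic_word P w \<longleftrightarrow>
     set w \<subseteq> \<Union>P \<and> (\<forall>B\<in>P. length (filter (\<lambda>x. x \<in> B) w) \<le> 1)"

definition generic :: "'x set set \<Rightarrow> 'x list list \<Rightarrow> bool" where
  "generic P t \<longleftrightarrow> t \<noteq> [] \<and> generic_word P (concat t)"

section \<open>The category \<open>Gen\<^sub>X\<close>\<close>

text \<open>
  \<open>gen_arrow P t t'\<close>: the linear map \<open>V\<^sub>t \<rightarrow> V\<^sub>t'\<close>, \<open>t \<mapsto> t'\<close>, is obtained from the generating maps
  by composition and by tensoring. Since all the spaces \<open>V\<^sub>t\<close> are lines with chosen generator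
  and all the generating maps send generator to generator, the space of morphisms
  \<open>V\<^sub>t \<rightarrow> V\<^sub>t'\<close> consists of all the linear maps if \<open>gen_arrow P t t'\<close>, and only of \<open>0\<close> otherwise.
  The rule \<open>tensor\<close> makes the generic tensor product a bifunctor; without it only the cyclic
  permutations of the letters of a word would be available as symmetries, and a map such as
  \<open>id \<otimes> \<tau> \<otimes> id\<close> would not be a morphism.
\<close>

inductive gen_arrow :: "'x set set \<Rightarrow> 'x list list \<Rightarrow> 'x list list \<Rightarrow> bool"
  for P :: "'x set set"
  where
    same_word: "generic P t \<Longrightarrow> generic P t' \<Longrightarrow> concat t = concat t' \<Longrightarrow> gen_arrow P t t'"
  | substitute: "generic P t \<Longrightarrow> (\<And>B. B \<in> P \<Longrightarrow> \<sigma> ` B \<subseteq> B) \<Longrightarrow> gen_arrow P t (map (map \<sigma>) t)"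
  | erase: "generic P t \<Longrightarrow> gen_arrow P t (map (filter Q) t)"
  | symmetry: "generic P (s @ t) \<Longrightarrow> gen_arrow P (s @ t) (t @ s)"
  | tensor: "gen_arrow P s s' \<Longrightarrow> gen_arrow P t t' \<Longrightarrow> generic P (s @ t)
      \<Longrightarrow> gen_arrow P (s @ t) (s' @ t')"
  | trans: "gen_arrow P s t \<Longrightarrow> gen_arrow P t u \<Longrightarrow> gen_arrow P s u"

text \<open>
  An object is a direct sum \<open>\<Oplus>\<^bsub>a \<in> idx A\<^esub> V\<^bsub>lab A a\<^esub>\<close>; an index set, rather than a set of labels,
  allows multiple copies of the same \<open>V\<^sub>t\<close>. Its vectors are the finitely supported functions on
  \<open>idx A\<close>, realised as the elements of \<open>'a \<Rightarrow>\<^sub>0 'k\<close> with support contained in \<open>idx A\<close>.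
\<close>

record ('a, 'x) gen_obj =
  idx :: "'a set"
  lab :: "'a \<Rightarrow> 'x list list"

definition is_gen_obj :: "'x set set \<Rightarrow> ('a, 'x) gen_obj \<Rightarrow> bool" where
  "is_gen_obj P A \<longleftrightarrow> (\<forall>a\<in>idx A. generic P (lab A a))"

definition vecs :: "('a, 'x) gen_obj \<Rightarrow> ('a \<Rightarrow>\<^sub>0 'k::zero) set" where
  "vecs A = {v. Poly_Mapping.keys v \<subseteq> idx A}"

abbreviation bas :: "'a \<Rightarrow> ('a \<Rightarrow>\<^sub>0 'k::zero_neq_one)" where
  "bas a \<equiv> Poly_Mapping.single a 1"

definition scal :: "'k::mult_zero \<Rightarrow> ('a \<Rightarrow>\<^sub>0 'k) \<Rightarrow> ('a \<Rightarrow>\<^sub>0 'k)" where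
  "scal c v = Poly_Mapping.map (\<lambda>x. c * x) v"

text \<open>In the following two definitions \<open>s\<close> is the scalar multiplication of the target.\<close>

definition linear_on_vecs ::
    "('a, 'x) gen_obj \<Rightarrow> ('k::field \<Rightarrow> 'b::ab_group_add \<Rightarrow> 'b) \<Rightarrow> (('a \<Rightarrow>\<^sub>0 'k) \<Rightarrow> 'b) \<Rightarrow> bool" where
  "linear_on_vecs A s f \<longleftrightarrow>
     (\<forall>u\<in>vecs A. \<forall>v\<in>vecs A. f (u + v) = f u + f v) \<and>
     (\<forall>c. \<forall>v\<in>vecs A. f (scal c v) = s c (f v))"

definition lin_ext ::
    "('k::field \<Rightarrow> 'b::ab_group_add \<Rightarrow> 'b) \<Rightarrow> ('a \<Rightarrow> 'b) \<Rightarrow> ('a \<Rightarrow>\<^sub>0 'k) \<Rightarrow> 'b" where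
  "lin_ext s F v = (\<Sum>a\<in>Poly_Mapping.keys v. s (Poly_Mapping.lookup v a) (F a))"

definition gen_hom ::
    "'x set set \<Rightarrow> ('a, 'x) gen_obj \<Rightarrow> ('b, 'x) gen_obj
      \<Rightarrow> (('a \<Rightarrow>\<^sub>0 'k::field) \<Rightarrow> ('b \<Rightarrow>\<^sub>0 'k)) \<Rightarrow> bool" where
  "gen_hom P A B f \<longleftrightarrow>
     f ` vecs A \<subseteq> vecs B \<and> linear_on_vecs A scal f \<and>
     (\<forall>a\<in>idx A. \<forall>b\<in>Poly_Mapping.keys (f (bas a)). gen_arrow P (lab A a) (lab B b))"

definition gen_unit :: "(unit, 'x) gen_obj" where
  "gen_unit = \<lparr>idx = UNIV, lab = (\<lambda>_. [[]])\<rparr>"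

text \<open>
  Both \<open>A \<otimes> B\<close> and its subspace \<open>gen_tensor P A B\<close> consist of finitely supported functions on
  pairs, so the embedding of the latter into the former is an inclusion.
\<close>

definition gen_tensor ::
    "'x set set \<Rightarrow> ('a, 'x) gen_obj \<Rightarrow> ('b, 'x) gen_obj \<Rightarrow> ('a \<times> 'b, 'x) gen_obj" where
  "gen_tensor P A B =
     \<lparr>idx = {(a, b). a \<in> idx A \<and> b \<in> idx B \<and> generic P (lab A a @ lab B b)},
      lab = (\<lambda>(a, b). lab A a @ lab B b)\<rparr>"

definition generic_position ::
    "'x set set \<Rightarrow> ('a, 'x) gen_obj \<Rightarrow> ('b, 'x) gen_obj
      \<Rightarrow> ('a \<Rightarrow>\<^sub>0 'k::zero) \<Rightarrow> ('b \<Rightarrow>\<^sub>0 'k) \<Rightarrow> bool" where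
  "generic_position P A B u v \<longleftrightarrow>
     (\<forall>a\<in>Poly_Mapping.keys u. \<forall>b\<in>Poly_Mapping.keys v. generic P (lab A a @ lab B b))"

definition tens :: "('a \<Rightarrow>\<^sub>0 'k::field) \<Rightarrow> ('b \<Rightarrow>\<^sub>0 'k) \<Rightarrow> ('a \<times> 'b \<Rightarrow>\<^sub>0 'k)" where
  "tens u v = (\<Sum>a\<in>Poly_Mapping.keys u. \<Sum>b\<in>Poly_Mapping.keys v.
     Poly_Mapping.single (a, b) (Poly_Mapping.lookup u a * Poly_Mapping.lookup v b))"

text \<open>The map \<open>f \<otimes> g\<close>, for linear maps \<open>f\<close> and \<open>g\<close>.\<close>

definition tmap ::
    "(('a \<Rightarrow>\<^sub>0 'k::field) \<Rightarrow> ('c \<Rightarrow>\<^sub>0 'k)) \<Rightarrow> (('b \<Rightarrow>\<^sub>0 'k) \<Rightarrow> ('d \<Rightarrow>\<^sub>0 'k))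
      \<Rightarrow> ('a \<times> 'b \<Rightarrow>\<^sub>0 'k) \<Rightarrow> ('c \<times> 'd \<Rightarrow>\<^sub>0 'k)" where
  "tmap f g = lin_ext scal (\<lambda>(a, b). tens (f (bas a)) (g (bas b)))"

definition assoc_map :: "(('a \<times> 'b) \<times> 'c \<Rightarrow>\<^sub>0 'k::field) \<Rightarrow> ('a \<times> ('b \<times> 'c) \<Rightarrow>\<^sub>0 'k)" where
  "assoc_map = lin_ext scal (\<lambda>((a, b), c). bas (a, (b, c)))"

definition middle_swap ::
    "(('a \<times> 'b) \<times> ('c \<times> 'd) \<Rightarrow>\<^sub>0 'k::field) \<Rightarrow> (('a \<times> 'c) \<times> ('b \<times> 'd) \<Rightarrow>\<^sub>0 'k)" where
  "middle_swap = lin_ext scal (\<lambda>((a, b), (c, d)). bas ((a, c), (b, d)))"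

section \<open>Generic bialgebras\<close>

text \<open>The canonical generator of the unit object is \<open>bas ()\<close>.\<close>

locale gen_algebra =
  fixes P :: "'x set set"
    and H :: "('h, 'x) gen_obj"
    and \<pi> :: "('h \<times> 'h \<Rightarrow>\<^sub>0 'k::field) \<Rightarrow> ('h \<Rightarrow>\<^sub>0 'k)"
    and \<eta> :: "(unit \<Rightarrow>\<^sub>0 'k) \<Rightarrow> ('h \<Rightarrow>\<^sub>0 'k)"
  assumes obj: "is_gen_obj P H"
    and prod_hom: "gen_hom P (gen_tensor P H H) H \<pi>"
    and unit_hom: "gen_hom P gen_unit H \<eta>"
    and assoc: "w \<in> vecs (gen_tensor P (gen_tensor P H H) H)
      \<Longrightarrow> \<pi> (tmap \<pi> id w) = \<pi> (tmap id \<pi> (assoc_map w))"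
    and unit_left: "h \<in> vecs H \<Longrightarrow> \<pi> (tens (\<eta> (bas ())) h) = h"
    and unit_right: "h \<in> vecs H \<Longrightarrow> \<pi> (tens h (\<eta> (bas ()))) = h"

locale gen_coalgebra =
  fixes P :: "'x set set"
    and H :: "('h, 'x) gen_obj"
    and \<Delta> :: "('h \<Rightarrow>\<^sub>0 'k::field) \<Rightarrow> ('h \<times> 'h \<Rightarrow>\<^sub>0 'k)"
    and \<epsilon> :: "('h \<Rightarrow>\<^sub>0 'k) \<Rightarrow> (unit \<Rightarrow>\<^sub>0 'k)"
  assumes obj: "is_gen_obj P H"
    and coprod_hom: "gen_hom P H (gen_tensor P H H) \<Delta>"
    and counit_hom: "gen_hom P H gen_unit \<epsilon>"
    and coassoc: "h \<in> vecs H \<Longrightarrow> assoc_map (tmap \<Delta> id (\<Delta> h)) = tmap id \<Delta> (\<Delta> h)"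
    and counit_left: "h \<in> vecs H \<Longrightarrow> tmap \<epsilon> id (\<Delta> h) = tens (bas ()) h"
    and counit_right: "h \<in> vecs H \<Longrightarrow> tmap id \<epsilon> (\<Delta> h) = tens h (bas ())"

locale gen_bialgebra =
  gen_algebra P H \<pi> \<eta> + gen_coalgebra P H \<Delta> \<epsilon>
  for P :: "'x set set"
    and H :: "('h, 'x) gen_obj"
    and \<pi> :: "('h \<times> 'h \<Rightarrow>\<^sub>0 'k::field) \<Rightarrow> ('h \<Rightarrow>\<^sub>0 'k)"
    and \<eta> :: "(unit \<Rightarrow>\<^sub>0 'k) \<Rightarrow> ('h \<Rightarrow>\<^sub>0 'k)"
    and \<Delta> :: "('h \<Rightarrow>\<^sub>0 'k) \<Rightarrow> ('h \<times> 'h \<Rightarrow>\<^sub>0 'k)"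
    and \<epsilon> :: "('h \<Rightarrow>\<^sub>0 'k) \<Rightarrow> (unit \<Rightarrow>\<^sub>0 'k)" +
  assumes coprod_prod: "w \<in> vecs (gen_tensor P H H)
      \<Longrightarrow> \<Delta> (\<pi> w) = tmap \<pi> \<pi> (middle_swap (tmap \<Delta> \<Delta> w))"
    and coprod_unit: "\<Delta> (\<eta> (bas ())) = tens (\<eta> (bas ())) (\<eta> (bas ()))"
    and counit_prod: "w \<in> vecs (gen_tensor P H H)
      \<Longrightarrow> tens (bas ()) (\<epsilon> (\<pi> w)) = tmap \<epsilon> \<epsilon> w"
    and counit_unit: "\<epsilon> (\<eta> (bas ())) = bas ()"

definition sub_sum :: "('a, 'x) gen_obj \<Rightarrow> ('a \<Rightarrow> bool) \<Rightarrow> ('a, 'x) gen_obj" where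
  "sub_sum A Q = \<lparr>idx = {a \<in> idx A. Q a}, lab = lab A\<rparr>"

text \<open>
  A decomposition \<open>H = \<Oplus>\<^sub>n H\<^sub>n\<close> in the category is a degree function \<open>deg\<close> on the index set: \<open>H\<^sub>n\<close>
  is the sum of the summands of degree \<open>n\<close>. The index \<open>e\<close> is that of the only summand of \<open>H\<^sub>0\<close>, so
  that \<open>bas e\<close> is the element \<open>\<emptyset>\<close> of \<open>H\<close>.
\<close>

locale standard_generic_bialgebra =
  gen_bialgebra P H \<pi> \<eta> \<Delta> \<epsilon>
  for P :: "'x set set"
    and H :: "('h, 'x) gen_obj"
    and \<pi> :: "('h \<times> 'h \<Rightarrow>\<^sub>0 'k::field) \<Rightarrow> ('h \<Rightarrow>\<^sub>0 'k)"
    and \<eta> :: "(unit \<Rightarrow>\<^sub>0 'k) \<Rightarrow> ('h \<Rightarrow>\<^sub>0 'k)"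
    and \<Delta> :: "('h \<Rightarrow>\<^sub>0 'k) \<Rightarrow> ('h \<times> 'h \<Rightarrow>\<^sub>0 'k)"
    and \<epsilon> :: "('h \<Rightarrow>\<^sub>0 'k) \<Rightarrow> (unit \<Rightarrow>\<^sub>0 'k)" +
  fixes deg :: "'h \<Rightarrow> nat" and e :: 'h
  assumes degree_0: "{a \<in> idx H. deg a = 0} = {e}" "lab H e = [[]]"
    and unit_empty: "\<eta> (bas ()) = bas e"
    and counit_empty: "h \<in> vecs H
      \<Longrightarrow> \<epsilon> h = Poly_Mapping.single () (Poly_Mapping.lookup h e)"
    and coprod_graded: "h \<in> vecs (sub_sum H (\<lambda>a. deg a = n))
      \<Longrightarrow> \<Delta> h \<in> vecs (sub_sum (gen_tensor P H H) (\<lambda>(a, b). deg a + deg b = n))"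
    and prod_filtered: "p > 0 \<Longrightarrow> q > 0
      \<Longrightarrow> w \<in> vecs (gen_tensor P (sub_sum H (\<lambda>a. deg a = p)) (sub_sum H (\<lambda>a. deg a = q)))
      \<Longrightarrow> \<pi> w \<in> vecs (sub_sum H (\<lambda>a. 0 < deg a \<and> deg a \<le> p + q))"

section \<open>Characters with values in a commutative algebra\<close>

text \<open>
  The sort \<open>{comm_ring, comm_monoid_mult}\<close> is that of commutative unital rings; unlike
  \<open>comm_ring_1\<close> it does not exclude the zero ring.
\<close>

locale comm_algebra = vector_space scale
  for scale :: "'k::field \<Rightarrow> 'b::{comm_ring, comm_monoid_mult} \<Rightarrow> 'b" +
  assumes scale_mult: "scale c (x * y) = scale c x * y"

definition alg_hom ::
    "('k::field \<Rightarrow> 'b::{comm_ring, comm_monoid_mult} \<Rightarrow> 'b)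
      \<Rightarrow> ('k \<Rightarrow> 'c::{comm_ring, comm_monoid_mult} \<Rightarrow> 'c) \<Rightarrow> ('b \<Rightarrow> 'c) \<Rightarrow> bool" where
  "alg_hom sB sC f \<longleftrightarrow>
     Vector_Spaces.linear sB sC f \<and> (\<forall>x y. f (x * y) = f x * f y) \<and> f 1 = 1"

text \<open>Maps with source the space \<open>H\<close> are made unique by extensionality outside \<open>vecs H\<close>.\<close>

definition characters ::
    "'x set set \<Rightarrow> ('h, 'x) gen_obj \<Rightarrow> (('h \<times> 'h \<Rightarrow>\<^sub>0 'k::field) \<Rightarrow> ('h \<Rightarrow>\<^sub>0 'k)) \<Rightarrow> 'h
      \<Rightarrow> ('k \<Rightarrow> 'b::{comm_ring, comm_monoid_mult} \<Rightarrow> 'b) \<Rightarrow> (('h \<Rightarrow>\<^sub>0 'k) \<Rightarrow> 'b) set" where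
  "characters P H \<pi> e sB =
     {\<phi> \<in> extensional (vecs H). linear_on_vecs H sB \<phi> \<and> \<phi> (bas e) = 1 \<and>
        (\<forall>h1\<in>vecs H. \<forall>h2\<in>vecs H. generic_position P H H h1 h2
           \<longrightarrow> \<phi> (\<pi> (tens h1 h2)) = \<phi> h1 * \<phi> h2)}"

text \<open>The linear map \<open>m\<^sub>B \<circ> (\<phi> \<otimes> \<psi>)\<close> sends \<open>a \<otimes> b\<close> to \<open>\<phi>(a) \<psi>(b)\<close>.\<close>

definition convolution ::
    "('h, 'x) gen_obj \<Rightarrow> (('h \<Rightarrow>\<^sub>0 'k::field) \<Rightarrow> ('h \<times> 'h \<Rightarrow>\<^sub>0 'k))
      \<Rightarrow> ('k \<Rightarrow> 'b::{comm_ring, comm_monoid_mult} \<Rightarrow> 'b)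
      \<Rightarrow> (('h \<Rightarrow>\<^sub>0 'k) \<Rightarrow> 'b) \<Rightarrow> (('h \<Rightarrow>\<^sub>0 'k) \<Rightarrow> 'b) \<Rightarrow> (('h \<Rightarrow>\<^sub>0 'k) \<Rightarrow> 'b)" where
  "convolution H \<Delta> sB \<phi> \<psi> =
     (\<lambda>h\<in>vecs H. lin_ext sB (\<lambda>(a, b). \<phi> (bas a) * \<psi> (bas b)) (\<Delta> h))"

text \<open>The neutral element is the counit followed by the unit map of the algebra.\<close>

definition char_group ::
    "'x set set \<Rightarrow> ('h, 'x) gen_obj \<Rightarrow> (('h \<times> 'h \<Rightarrow>\<^sub>0 'k::field) \<Rightarrow> ('h \<Rightarrow>\<^sub>0 'k))
      \<Rightarrow> (('h \<Rightarrow>\<^sub>0 'k) \<Rightarrow> ('h \<times> 'h \<Rightarrow>\<^sub>0 'k)) \<Rightarrow> 'h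
      \<Rightarrow> ('k \<Rightarrow> 'b::{comm_ring, comm_monoid_mult} \<Rightarrow> 'b) \<Rightarrow> (('h \<Rightarrow>\<^sub>0 'k) \<Rightarrow> 'b) monoid" where
  "char_group P H \<pi> \<Delta> e sB =
     \<lparr>carrier = characters P H \<pi> e sB,
      monoid.mult = convolution H \<Delta> sB,
      one = (\<lambda>h\<in>vecs H. sB (Poly_Mapping.lookup h e) 1)\<rparr>"

definition char_map ::
    "('h, 'x) gen_obj \<Rightarrow> ('b \<Rightarrow> 'c) \<Rightarrow> (('h \<Rightarrow>\<^sub>0 'k::zero) \<Rightarrow> 'b) \<Rightarrow> (('h \<Rightarrow>\<^sub>0 'k) \<Rightarrow> 'c)" where
  "char_map H f \<phi> = compose (vecs H) f \<phi>"

end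

theory Submission
  imports Defs
begin

text \<open>
  A linear map on \<open>H\<close> is determined by its values on the basis, so that a character is encoded by a
  function \<open>F\<close> on the indices with \<open>F(e) = 1\<close> and \<open>F(ab) = F(a) F(b)\<close> for all basis elements
  \<open>a\<close>, \<open>b\<close> in generic position, where \<open>F\<close> is extended linearly to the product \<open>ab\<close>
  (\<open>characters_eq\<close>). On such functions the group axioms are checked as for an ordinary connected
  graded bialgebra, with attention to generic positions. Write \<open>a'\<close>, \<open>a''\<close> for the two legs of
  the terms of \<open>\<Delta> a\<close>.

  Associativity and the neutral element come from coassociativity and the counit. A convolution of
  two characters is a character because \<open>\<Delta>\<close> is multiplicative and the target algebra is
  commutative; the one point specific to the generic setting is that the products \<open>a'b'\<close> and
  \<open>a''b''\<close> in \<open>\<Delta>(ab)\<close> are again products of elements in generic position. This holds because no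
  morphism of the category creates letters in a block (\<open>gen_arrow_block_count\<close>).

  The gradation and the counit together say that \<open>\<Delta> a\<close> is \<open>a \<otimes> \<emptyset>\<close> plus terms whose left leg has
  degree less than that of \<open>a\<close> (\<open>L_coprod_split\<close>). Hence the equation \<open>F * G = \<epsilon>\<close> can be solved for
  \<open>F\<close> by recursion on the degree as soon as \<open>G(e) = 1\<close> (\<open>left_inverse_exists\<close>). If \<open>G\<close> is a
  character, so is \<open>F\<close> (\<open>left_inverse_multiplicative\<close>): the defect
  \<open>d(a, b) = F(ab) - F(a) F(b)\<close> satisfies
  \<open>\<Sum> d(a', b') G(a'') G(b'') = (F * G)(ab) - (F * G)(a) (F * G)(b) = \<epsilon>(ab) - \<epsilon>(a) \<epsilon>(b) = 0\<close>, and the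
  only term of this sum that does not vanish by induction on \<open>deg a + deg b\<close> is \<open>d(a, b)\<close> itself.
  Left inverses suffice for a group. Functoriality holds since algebra morphisms commute with
  linear extension and preserve products.
\<close>

section \<open>Linear extensions\<close>

lemma lookup_scal [simp]: "Poly_Mapping.lookup (scal c v) a = c * Poly_Mapping.lookup v a"
  for c :: "'k::field"
  by (simp add: scal_def Poly_Mapping.map.rep_eq when_def)

lemma keys_scal_subset: "Poly_Mapping.keys (scal c v) \<subseteq> Poly_Mapping.keys v"
  for c :: "'k::field"
  by (auto simp: in_keys_iff)

interpretation scal: vector_space "scal :: 'k::field \<Rightarrow> ('a \<Rightarrow>\<^sub>0 'k) \<Rightarrow> ('a \<Rightarrow>\<^sub>0 'k)"
  by unfold_locales (auto intro!: poly_mapping_eqI simp: lookup_add algebra_simps)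

lemma bas_in_vecs [simp]: "(bas a :: 'a \<Rightarrow>\<^sub>0 'k::zero_neq_one) \<in> vecs A \<longleftrightarrow> a \<in> idx A"
  by (simp add: vecs_def)

lemma vecs_keysD: "v \<in> vecs A \<Longrightarrow> a \<in> Poly_Mapping.keys v \<Longrightarrow> a \<in> idx A"
  by (auto simp: vecs_def)

lemma vecs_add: "u \<in> vecs A \<Longrightarrow> v \<in> vecs A \<Longrightarrow> u + v \<in> vecs A"
  for u v :: "'a \<Rightarrow>\<^sub>0 'k::field"
  using Poly_Mapping.keys_add[of u v] by (auto simp: vecs_def)

lemma vecs_scal: "v \<in> vecs A \<Longrightarrow> scal c v \<in> vecs A"
  for c :: "'k::field"
  using keys_scal_subset[of c v] by (auto simp: vecs_def)

lemma vecs_sum: "(\<And>i. i \<in> S \<Longrightarrow> f i \<in> vecs A) \<Longrightarrow> (\<Sum>i\<in>S. f i) \<in> vecs A"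
  for f :: "'i \<Rightarrow> 'a \<Rightarrow>\<^sub>0 'k::field"
proof (induction S rule: infinite_finite_induct)
  case (insert x F)
  then show ?case by (simp add: vecs_add)
qed (simp_all add: vecs_def)

context vector_space
begin

lemma lin_ext_superset:
  assumes "finite S" "Poly_Mapping.keys v \<subseteq> S"
  shows "lin_ext scale F v = (\<Sum>a\<in>S. Poly_Mapping.lookup v a *s F a)"
  unfolding lin_ext_def
  by (rule sum.mono_neutral_left) (use assms in \<open>auto simp: in_keys_iff\<close>)

lemma lin_ext_zero [simp]: "lin_ext scale F 0 = 0"
  by (simp add: lin_ext_def)

lemma lin_ext_single [simp]: "lin_ext scale F (Poly_Mapping.single a c) = c *s F a"
  by (subst lin_ext_superset[of "{a}"]) auto

lemma lin_ext_add: "lin_ext scale F (u + v) = lin_ext scale F u + lin_ext scale F v"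
proof -
  let ?S = "Poly_Mapping.keys u \<union> Poly_Mapping.keys v"
  have "Poly_Mapping.keys (u + v) \<subseteq> ?S" by (rule Poly_Mapping.keys_add)
  then show ?thesis
    by (simp add: lin_ext_superset[of ?S] lookup_add scale_left_distrib sum.distrib)
qed

lemma lin_ext_scal: "lin_ext scale F (scal c v) = c *s lin_ext scale F v"
  using keys_scal_subset[of c v]
  by (simp add: lin_ext_superset[of "Poly_Mapping.keys v"] scale_sum_right)

lemma lin_ext_sum: "lin_ext scale F (\<Sum>i\<in>S. v i) = (\<Sum>i\<in>S. lin_ext scale F (v i))"
  by (induction S rule: infinite_finite_induct) (simp_all add: lin_ext_add)

lemma lin_ext_cong:
  "(\<And>a. a \<in> Poly_Mapping.keys v \<Longrightarrow> F a = G a) \<Longrightarrow> lin_ext scale F v = lin_ext scale G v"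
  by (simp add: lin_ext_def)

lemma lin_ext_lin_ext:
  "lin_ext scale F (lin_ext scal G v) = lin_ext scale (\<lambda>a. lin_ext scale F (G a)) v"
  by (subst (2 3) lin_ext_def) (simp add: lin_ext_sum lin_ext_scal)

lemma lin_ext_diff:
  "lin_ext scale (\<lambda>a. F a - G a) v = lin_ext scale F v - lin_ext scale G v"
  by (simp add: lin_ext_def scale_right_diff_distrib sum_subtractf)

text \<open>
  An iterated extension instead of a double sum: in this form the scalars can be moved one factor at
  a time.
\<close>

lemma lin_ext_tens:
  "lin_ext scale F (tens u v) = lin_ext scale (\<lambda>a. lin_ext scale (\<lambda>b. F (a, b)) v) u"
  unfolding tens_def lin_ext_sum lin_ext_single
  by (simp add: lin_ext_def scale_sum_right)

lemma lin_ext_tmap: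
  "lin_ext scale F (tmap f g w)
    = lin_ext scale (\<lambda>(a, b). lin_ext scale F (tens (f (bas a)) (g (bas b)))) w"
  by (simp add: tmap_def lin_ext_lin_ext case_prod_unfold)

lemma lin_ext_assoc_map:
  "lin_ext scale F (assoc_map w) = lin_ext scale (\<lambda>((a, b), c). F (a, (b, c))) w"
  by (simp add: assoc_map_def lin_ext_lin_ext case_prod_unfold)

lemma lin_ext_middle_swap:
  "lin_ext scale F (middle_swap w) = lin_ext scale (\<lambda>((a, b), (c, d)). F ((a, c), (b, d))) w"
  by (simp add: middle_swap_def lin_ext_lin_ext case_prod_unfold)

text \<open>
  With this lemma every identity between linear maps is checked on the basis.
\<close>

lemma linear_on_vecs_eq_lin_ext:
  assumes f: "linear_on_vecs A scale f" and v: "v \<in> vecs A"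
  shows "f v = lin_ext scale (\<lambda>a. f (bas a)) v"
proof -
  have f0: "f 0 = 0"
  proof -
    have "0 \<in> vecs A" by (simp add: vecs_def)
    have "f (0 + 0) = f 0 + f 0"
      using f \<open>0 \<in> vecs A\<close> unfolding linear_on_vecs_def by blast
    then show ?thesis by simp
  qed
  have sum: "f (\<Sum>a\<in>S. scal (c a) (bas a)) = (\<Sum>a\<in>S. c a *s f (bas a))"
    if "finite S" "S \<subseteq> idx A" for S c
    using that
  proof (induction S)
    case (insert x S)
    have "scal (c x) (bas x) \<in> vecs A" "(\<Sum>a\<in>S. scal (c a) (bas a)) \<in> vecs A"
      using insert.prems by (auto intro!: vecs_sum vecs_scal)
    then show ?case
      using insert f by (simp add: linear_on_vecs_def)
  qed (simp add: f0)
  have "v = (\<Sum>a\<in>Poly_Mapping.keys v. scal (Poly_Mapping.lookup v a) (bas a))"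
    by (rule poly_mapping_eqI)
      (auto simp: lookup_sum lookup_single when_def in_keys_iff if_distrib sum.delta cong: if_cong)
  then have "f v = (\<Sum>a\<in>Poly_Mapping.keys v. Poly_Mapping.lookup v a *s f (bas a))"
    using sum[of "Poly_Mapping.keys v" "Poly_Mapping.lookup v"] v by (simp add: vecs_def)
  then show ?thesis by (simp add: lin_ext_def)
qed

end

lemma lookup_tens [simp]:
  "Poly_Mapping.lookup (tens u v) (a, b) = Poly_Mapping.lookup u a * Poly_Mapping.lookup v b"
proof -
  have "Poly_Mapping.lookup (tens u v) (a, b) =
    (\<Sum>a'\<in>Poly_Mapping.keys u. \<Sum>b'\<in>Poly_Mapping.keys v.
      if a' = a then if b' = b then Poly_Mapping.lookup u a' * Poly_Mapping.lookup v b' else 0 else 0)"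
    unfolding tens_def lookup_sum by (intro sum.cong refl) (auto simp: lookup_single when_def)
  also have "\<dots> = (\<Sum>a'\<in>Poly_Mapping.keys u.
      if a' = a then Poly_Mapping.lookup u a' * Poly_Mapping.lookup v b else 0)"
    by (intro sum.cong refl) (auto simp: sum.delta in_keys_iff)
  also have "\<dots> = Poly_Mapping.lookup u a * Poly_Mapping.lookup v b"
    by (auto simp: sum.delta in_keys_iff)
  finally show ?thesis .
qed

lemma lookup_lin_ext:
  "Poly_Mapping.lookup (lin_ext scal F v) b
    = (\<Sum>a\<in>Poly_Mapping.keys v. Poly_Mapping.lookup v a * Poly_Mapping.lookup (F a) b)"
  by (simp add: lin_ext_def lookup_sum)

lemma keys_tens: "Poly_Mapping.keys (tens u v) = Poly_Mapping.keys u \<times> Poly_Mapping.keys v"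
  by (auto simp: in_keys_iff)

lemma tens_bas [simp]: "tens (bas a) (bas b) = bas (a, b)"
  by (simp add: tens_def)

section \<open>Morphisms do not create letters\<close>

definition block_count :: "'x set \<Rightarrow> 'x list list \<Rightarrow> nat" where
  "block_count B t = length (filter (\<lambda>x. x \<in> B) (concat t))"

lemma block_count_append: "block_count B (s @ t) = block_count B s + block_count B t"
  by (simp add: block_count_def)

lemma generic_iff:
  "generic P t \<longleftrightarrow> t \<noteq> [] \<and> set (concat t) \<subseteq> \<Union>P \<and> (\<forall>B\<in>P. block_count B t \<le> 1)"
  by (simp add: generic_def generic_word_def block_count_def)

text \<open>
  Substitutions keep every letter in its block, hence preserve the block counts, since the blocks
  are disjoint; erasing letters can only lower them; the other generating maps move letters around.
\<close>

lemma gen_arrow_block_count: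
  fixes P :: "'x set set"
  assumes "gen_arrow P t t'" and "disjoint P"
  shows "t' \<noteq> [] \<and> set (concat t') \<subseteq> \<Union>P \<and> (\<forall>B\<in>P. block_count B t' \<le> block_count B t)"
  using assms(1)
proof induction
  case (same_word t t')
  then show ?case by (simp add: generic_iff block_count_def)
next
  case (substitute t \<sigma>)
  have \<sigma>: "\<sigma> x \<in> B \<longleftrightarrow> x \<in> B" if "x \<in> \<Union>P" "B \<in> P" for x B
    using that substitute(2) \<open>disjoint P\<close> unfolding disjoint_def by blast
  have sub: "set (concat t) \<subseteq> \<Union>P" using substitute by (simp add: generic_iff)
  have "block_count B (map (map \<sigma>) t) = block_count B t" if "B \<in> P" for B
  proof -
    have "filter (\<lambda>x. \<sigma> x \<in> B) (concat t) = filter (\<lambda>x. x \<in> B) (concat t)"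
      by (rule filter_cong[OF refl]) (use sub \<sigma> that in blast)
    then show ?thesis
      by (simp add: block_count_def map_concat[symmetric] filter_map comp_def)
  qed
  moreover have "set (concat (map (map \<sigma>) t)) = \<sigma> ` set (concat t)"
    by (simp add: map_concat[symmetric])
  moreover have "\<sigma> ` set (concat t) \<subseteq> \<Union>P" using sub \<sigma> by fastforce
  ultimately show ?case using substitute by (simp add: generic_iff)
next
  case (erase t Q)
  have "concat (map (filter Q) t) = filter Q (concat t)" by (simp add: filter_concat)
  moreover have "length (filter R (filter Q xs)) \<le> length (filter R xs)" for R and xs :: "'x list"
    by (induction xs) auto
  ultimately show ?case using erase
    by (auto simp: generic_iff block_count_def simp del: filter_filter)
next
  case (symmetry s t)
  then show ?case by (auto simp: generic_iff block_count_append)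
next
  case (tensor s s' t t')
  then show ?case by (auto simp: block_count_append intro: add_mono)
next
  case (trans s t u)
  then show ?case by (meson le_trans)
qed

text \<open>
  The form in which the previous lemma is applied: \<open>s1 \<otimes> s2\<close> and \<open>t1 \<otimes> t2\<close> are the labels of terms of
  the coproducts of generators labelled \<open>s\<close> and \<open>t\<close>.
\<close>

lemma gen_arrow_generic_tensor:
  assumes "disjoint P" "gen_arrow P s (s1 @ s2)" "gen_arrow P t (t1 @ t2)" "generic P (s @ t)"
    and "s1 \<noteq> []" "s2 \<noteq> []"
  shows "generic P (s1 @ t1)" "generic P (s2 @ t2)"
proof -
  have s: "set (concat s1) \<subseteq> \<Union>P" "set (concat s2) \<subseteq> \<Union>P"
      "\<And>B. B \<in> P \<Longrightarrow> block_count B s1 + block_count B s2 \<le> block_count B s"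
    using gen_arrow_block_count[OF assms(2,1)] by (auto simp: block_count_append)
  have t: "set (concat t1) \<subseteq> \<Union>P" "set (concat t2) \<subseteq> \<Union>P"
      "\<And>B. B \<in> P \<Longrightarrow> block_count B t1 + block_count B t2 \<le> block_count B t"
    using gen_arrow_block_count[OF assms(3,1)] by (auto simp: block_count_append)
  have st: "\<And>B. B \<in> P \<Longrightarrow> block_count B s + block_count B t \<le> 1"
    using assms(4) by (simp add: generic_iff block_count_append)
  have "block_count B s1 + block_count B t1 \<le> 1" "block_count B s2 + block_count B t2 \<le> 1"
    if "B \<in> P" for B
    using s(3)[OF that] t(3)[OF that] st[OF that] by linarith+
  then show "generic P (s1 @ t1)" "generic P (s2 @ t2)"
    using s t assms(5,6) by (auto simp: generic_iff block_count_append)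
qed


section \<open>Convolution of functions on the basis\<close>

text \<open>
  Disjointness of the blocks makes substitutions preserve generic words; only with it are the
  targets of the morphisms of the category again generic.
\<close>

locale characters_of_standard_bialgebra =
  standard_generic_bialgebra P H \<pi> \<eta> \<Delta> \<epsilon> deg e + comm_algebra scale
  for P :: "'x set set"
    and H :: "('h, 'x) gen_obj"
    and \<pi> :: "('h \<times> 'h \<Rightarrow>\<^sub>0 'k::field) \<Rightarrow> ('h \<Rightarrow>\<^sub>0 'k)"
    and \<eta> :: "(unit \<Rightarrow>\<^sub>0 'k) \<Rightarrow> ('h \<Rightarrow>\<^sub>0 'k)"
    and \<Delta> :: "('h \<Rightarrow>\<^sub>0 'k) \<Rightarrow> ('h \<times> 'h \<Rightarrow>\<^sub>0 'k)"
    and \<epsilon> :: "('h \<Rightarrow>\<^sub>0 'k) \<Rightarrow> (unit \<Rightarrow>\<^sub>0 'k)"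
    and deg :: "'h \<Rightarrow> nat" and e :: 'h
    and scale :: "'k \<Rightarrow> 'b::{comm_ring, comm_monoid_mult} \<Rightarrow> 'b" +
  assumes disjoint_blocks: "disjoint P"
begin

notation scale (infixr \<open>*s\<close> 75)

abbreviation L :: "('c \<Rightarrow> 'b) \<Rightarrow> ('c \<Rightarrow>\<^sub>0 'k) \<Rightarrow> 'b" where
  "L \<equiv> lin_ext scale"

abbreviation HH :: "('h \<times> 'h, 'x) gen_obj" where
  "HH \<equiv> gen_tensor P H H"

definition conv :: "('h \<Rightarrow> 'b) \<Rightarrow> ('h \<Rightarrow> 'b) \<Rightarrow> 'h \<Rightarrow> 'b" where
  "conv F G a = L (\<lambda>(x, y). F x * G y) (\<Delta> (bas a))"

definition counit_fun :: "'h \<Rightarrow> 'b" where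
  "counit_fun a = (if a = e then 1 else 0)"

text \<open>
  A function on the basis whose linear extension is a character; see \<open>characters_eq\<close>.
\<close>

definition multiplicative :: "('h \<Rightarrow> 'b) \<Rightarrow> bool" where
  "multiplicative F \<longleftrightarrow> F e = 1 \<and> (\<forall>(a, b) \<in> idx HH. L F (\<pi> (bas (a, b))) = F a * F b)"

lemma multiplicative_e: "multiplicative F \<Longrightarrow> F e = 1"
  by (simp add: multiplicative_def)

lemma multiplicativeD:
  "multiplicative F \<Longrightarrow> (a, b) \<in> idx HH \<Longrightarrow> L F (\<pi> (bas (a, b))) = F a * F b"
  by (auto simp: multiplicative_def)

lemma scale_mult_right: "c *s (x * y) = x * (c *s y)"
  by (metis mult.commute scale_mult)

lemma L_mult_left: "x * L F v = L (\<lambda>a. x * F a) v"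
  by (simp add: lin_ext_def sum_distrib_left scale_mult_right)

lemma L_mult_right: "L F v * x = L (\<lambda>a. F a * x) v"
  by (simp add: lin_ext_def sum_distrib_right scale_mult)

lemma L_tens_mult: "L (\<lambda>(a, b). F a * G b) (tens u v) = L F u * L G v"
  by (simp only: lin_ext_tens prod.case L_mult_left[symmetric] L_mult_right[symmetric])

lemma L_counit_fun: "L counit_fun v = Poly_Mapping.lookup v e *s 1"
proof -
  let ?S = "insert e (Poly_Mapping.keys v)"
  have "L counit_fun v = (\<Sum>a\<in>?S. Poly_Mapping.lookup v a *s counit_fun a)"
    by (rule lin_ext_superset) auto
  also have "\<dots> = (\<Sum>a\<in>?S. if a = e then Poly_Mapping.lookup v a *s 1 else 0)"
    by (intro sum.cong) (auto simp: counit_fun_def)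
  finally show ?thesis by (simp add: sum.delta)
qed

lemma e_in_H: "e \<in> idx H"
  using degree_0(1) by auto

lemma deg_eq_0_iff: "a \<in> idx H \<Longrightarrow> deg a = 0 \<longleftrightarrow> a = e"
  using degree_0(1) by auto

lemma in_HH_iff: "(a, b) \<in> idx HH \<longleftrightarrow> a \<in> idx H \<and> b \<in> idx H \<and> generic P (lab H a @ lab H b)"
  by (simp add: gen_tensor_def)

lemma lin_coprod: "linear_on_vecs H scal \<Delta>" and coprod_in_HH: "h \<in> vecs H \<Longrightarrow> \<Delta> h \<in> vecs HH"
  using coprod_hom by (auto simp: gen_hom_def)

lemma lin_prod: "linear_on_vecs HH scal \<pi>" and prod_in_H: "w \<in> vecs HH \<Longrightarrow> \<pi> w \<in> vecs H"
  using prod_hom by (auto simp: gen_hom_def)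

lemma L_coprod: "h \<in> vecs H \<Longrightarrow> L K (\<Delta> h) = L (\<lambda>a. L K (\<Delta> (bas a))) h"
  by (subst scal.linear_on_vecs_eq_lin_ext[OF lin_coprod]) (simp_all add: lin_ext_lin_ext)

lemma L_prod: "w \<in> vecs HH \<Longrightarrow> L K (\<pi> w) = L (\<lambda>p. L K (\<pi> (bas p))) w"
  by (subst scal.linear_on_vecs_eq_lin_ext[OF lin_prod]) (simp_all add: lin_ext_lin_ext)

lemma L_conv: "h \<in> vecs H \<Longrightarrow> L (conv F G) h = L (\<lambda>(x, y). F x * G y) (\<Delta> h)"
  by (simp add: L_coprod[of h "\<lambda>(x, y). F x * G y"] conv_def[abs_def])

lemma coprod_keys:
  assumes "a \<in> idx H" "(x, y) \<in> Poly_Mapping.keys (\<Delta> (bas a))"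
  shows "x \<in> idx H" "y \<in> idx H" "gen_arrow P (lab H a) (lab H x @ lab H y)"
    and "deg x + deg y = deg a"
proof -
  show "x \<in> idx H" "y \<in> idx H"
    using vecs_keysD[OF coprod_in_HH assms(2)] assms(1) by (auto simp: in_HH_iff)
  show "gen_arrow P (lab H a) (lab H x @ lab H y)"
    using coprod_hom assms by (fastforce simp: gen_hom_def gen_tensor_def)
  have "bas a \<in> (vecs (sub_sum H (\<lambda>b. deg b = deg a)) :: ('h \<Rightarrow>\<^sub>0 'k) set)"
    using assms(1) by (simp add: sub_sum_def)
  from vecs_keysD[OF coprod_graded[OF this] assms(2)]
  show "deg x + deg y = deg a" by (simp add: sub_sum_def)
qed

text \<open>
  All the products that occur when \<open>\<Delta>\<close> is applied to a product of generators in generic position are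
  products in generic position, so that multiplicativity applies to them.
\<close>

lemma coprod_keys_generic:
  assumes "(a, b) \<in> idx HH" "(x, y) \<in> Poly_Mapping.keys (\<Delta> (bas a))"
    and "(x', y') \<in> Poly_Mapping.keys (\<Delta> (bas b))"
  shows "(x, x') \<in> idx HH" "(y, y') \<in> idx HH"
proof -
  have ab: "a \<in> idx H" "b \<in> idx H" "generic P (lab H a @ lab H b)"
    using assms(1) by (auto simp: in_HH_iff)
  note x = coprod_keys[OF ab(1) assms(2)] and x' = coprod_keys[OF ab(2) assms(3)]
  have "lab H x \<noteq> []" "lab H y \<noteq> []"
    using x(1,2) gen_algebra.obj[OF gen_algebra_axioms] by (auto simp: is_gen_obj_def generic_def)
  from gen_arrow_generic_tensor[OF disjoint_blocks x(3) x'(3) ab(3) this]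
  show "(x, x') \<in> idx HH" "(y, y') \<in> idx HH"
    using x x' by (auto simp: in_HH_iff)
qed

text \<open>
  The left and the right counit axioms determine the terms of \<open>\<Delta> a\<close> with one leg equal to \<open>\<emptyset>\<close>: they
  are \<open>\<emptyset> \<otimes> a\<close> and \<open>a \<otimes> \<emptyset>\<close>.
\<close>

lemma coprod_counit_coeff_left:
  assumes a: "a \<in> idx H"
  shows "Poly_Mapping.lookup (\<Delta> (bas a)) (e, z) = (if z = a then 1 else 0)"
proof -
  let ?v = "\<Delta> (bas a)"
  have "(if z = a then 1 else 0) = Poly_Mapping.lookup (tmap \<epsilon> id ?v) ((), z)"
    using counit_left[of "bas a"] a by (auto simp: lookup_single when_def)
  also have "\<dots> = (\<Sum>p\<in>Poly_Mapping.keys ?v. if p = (e, z) then Poly_Mapping.lookup ?v p else 0)"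
    unfolding tmap_def lookup_lin_ext
  proof (intro sum.cong refl, clarify)
    fix x y' assume "(x, y') \<in> Poly_Mapping.keys ?v"
    then have "x \<in> idx H" using coprod_keys[OF a] by blast
    then have "\<epsilon> (bas x) = Poly_Mapping.single () (if x = e then 1 else 0)"
      using counit_empty[of "bas x"] by (simp add: lookup_single when_def)
    then show "Poly_Mapping.lookup ?v (x, y') * Poly_Mapping.lookup (tens (\<epsilon> (bas x)) (id (bas y'))) ((), z)
        = (if (x, y') = (e, z) then Poly_Mapping.lookup ?v (x, y') else 0)"
      by (simp add: lookup_single when_def)
  qed
  also have "\<dots> = Poly_Mapping.lookup ?v (e, z)"
    by (simp add: sum.delta in_keys_iff)
  finally show ?thesis by simp
qed

lemma coprod_counit_coeff_right:
  assumes a: "a \<in> idx H"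
  shows "Poly_Mapping.lookup (\<Delta> (bas a)) (z, e) = (if z = a then 1 else 0)"
proof -
  let ?v = "\<Delta> (bas a)"
  have "(if z = a then 1 else 0) = Poly_Mapping.lookup (tmap id \<epsilon> ?v) (z, ())"
    using counit_right[of "bas a"] a by (auto simp: lookup_single when_def)
  also have "\<dots> = (\<Sum>p\<in>Poly_Mapping.keys ?v. if p = (z, e) then Poly_Mapping.lookup ?v p else 0)"
    unfolding tmap_def lookup_lin_ext
  proof (intro sum.cong refl, clarify)
    fix x y' assume "(x, y') \<in> Poly_Mapping.keys ?v"
    then have "y' \<in> idx H" using coprod_keys[OF a] by blast
    then have "\<epsilon> (bas y') = Poly_Mapping.single () (if y' = e then 1 else 0)"
      using counit_empty[of "bas y'"] by (simp add: lookup_single when_def)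
    then show "Poly_Mapping.lookup ?v (x, y') * Poly_Mapping.lookup (tens (id (bas x)) (\<epsilon> (bas y'))) (z, ())
        = (if (x, y') = (z, e) then Poly_Mapping.lookup ?v (x, y') else 0)"
      by (simp add: lookup_single when_def)
  qed
  also have "\<dots> = Poly_Mapping.lookup ?v (z, e)"
    by (simp add: sum.delta in_keys_iff)
  finally show ?thesis by simp
qed

text \<open>
  A term whose left leg has full degree has a right leg of degree \<open>0\<close>, which is therefore \<open>\<emptyset>\<close>; by the
  counit axiom this term is \<open>a \<otimes> \<emptyset>\<close>. This triangularity gives both the recursion for the inverse and
  the induction that proves it multiplicative.
\<close>

lemma L_coprod_split:
  assumes a: "a \<in> idx H"
  shows "L (\<lambda>(x, y). K x y) (\<Delta> (bas a))
    = K a e + L (\<lambda>(x, y). if deg x < deg a then K x y else 0) (\<Delta> (bas a))"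
proof -
  let ?v = "\<Delta> (bas a)"
  have top: "Poly_Mapping.lookup ?v (a, e) = 1"
    using coprod_counit_coeff_right[OF a] by simp
  let ?low = "\<lambda>(x, y). if deg x < deg a then K x y else 0"
  have "(case p of (x, y) \<Rightarrow> K x y) - ?low p = (if p = (a, e) then K a e else 0)" if p: "p \<in> Poly_Mapping.keys ?v" for p
  proof -
    obtain x y where xy: "p = (x, y)" by (cases p)
    note xy' = coprod_keys[OF a p[unfolded xy]]
    show ?thesis
    proof (cases "deg x < deg a")
      case False
      then have "y = e" using xy' deg_eq_0_iff[of y] by simp
      moreover from this have "x = a"
        using p xy coprod_counit_coeff_right[OF a, of x] by (auto simp: in_keys_iff split: if_splits)
      ultimately show ?thesis by (simp add: xy)
    qed (auto simp: xy)
  qed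
  then have "L (\<lambda>p. (case p of (x, y) \<Rightarrow> K x y) - ?low p) ?v = L (\<lambda>p. if p = (a, e) then K a e else 0) ?v"
    by (rule lin_ext_cong)
  also have "\<dots> = (\<Sum>p\<in>Poly_Mapping.keys ?v. if p = (a, e) then Poly_Mapping.lookup ?v p *s K a e else 0)"
    unfolding lin_ext_def by (intro sum.cong refl) auto
  also have "\<dots> = K a e"
    using top by (simp add: sum.delta in_keys_iff)
  finally show ?thesis by (simp add: lin_ext_diff algebra_simps)
qed

lemma conv_assoc:
  assumes a: "a \<in> idx H"
  shows "conv (conv F G) K a = conv F (conv G K) a"
proof -
  let ?v = "\<Delta> (bas a)"
  have "conv (conv F G) K a = L (\<lambda>((x, y), z). F x * (G y * K z)) (tmap \<Delta> id ?v)"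
    unfolding lin_ext_tmap conv_def[of _ K]
    by (intro lin_ext_cong) (auto simp: conv_def lin_ext_tens L_mult_right case_prod_unfold mult.assoc)
  also have "\<dots> = L (\<lambda>(x, (y, z)). F x * (G y * K z)) (assoc_map (tmap \<Delta> id ?v))"
    by (simp add: lin_ext_assoc_map case_prod_unfold)
  also have "\<dots> = L (\<lambda>(x, (y, z)). F x * (G y * K z)) (tmap id \<Delta> ?v)"
    using coassoc[of "bas a"] a by simp
  also have "\<dots> = conv F (conv G K) a"
    unfolding lin_ext_tmap conv_def[of F]
    by (intro lin_ext_cong) (auto simp: conv_def lin_ext_tens L_mult_left case_prod_unfold)
  finally show ?thesis .
qed

lemma conv_counit_left:
  assumes a: "a \<in> idx H"
  shows "conv counit_fun F a = F a"
proof -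
  have "conv counit_fun F a = (\<Sum>p\<in>Poly_Mapping.keys (\<Delta> (bas a)). if p = (e, a) then F a else 0)"
    unfolding conv_def lin_ext_def
  proof (intro sum.cong refl, clarify)
    fix x y assume "(x, y) \<in> Poly_Mapping.keys (\<Delta> (bas a))"
    then show "Poly_Mapping.lookup (\<Delta> (bas a)) (x, y) *s (counit_fun x * F y) =
        (if (x, y) = (e, a) then F a else 0)"
      using coprod_counit_coeff_left[OF a, of y]
      by (auto simp: counit_fun_def in_keys_iff split: if_splits)
  qed
  then show ?thesis
    using coprod_counit_coeff_left[OF a, of a] by (simp add: sum.delta in_keys_iff)
qed

lemma coprod_e: "\<Delta> (bas e) = bas (e, e)"
  using coprod_unit by (simp add: unit_empty)

lemma conv_e: "conv F G e = F e * G e"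
  by (simp add: conv_def coprod_e)

text \<open>
  Compatibility of product and coproduct, read through a pair of functions: \<open>(F * G)(ab)\<close> is the sum of
  the \<open>F(a'b') G(a''b'')\<close>.
\<close>

lemma L_coprod_prod:
  assumes ab: "(a, b) \<in> idx HH"
  shows "L (\<lambda>(x, y). F x * G y) (\<Delta> (\<pi> (bas (a, b)))) =
    L (\<lambda>((x, y), (x', y')). L F (\<pi> (bas (x, x'))) * L G (\<pi> (bas (y, y'))))
      (tens (\<Delta> (bas a)) (\<Delta> (bas b)))"
proof -
  have "\<Delta> (\<pi> (bas (a, b))) = tmap \<pi> \<pi> (middle_swap (tmap \<Delta> \<Delta> (bas (a, b))))"
    using coprod_prod[of "bas (a, b)"] ab by simp
  moreover have "L (\<lambda>(x, y). F x * G y) (tmap \<pi> \<pi> (middle_swap (tmap \<Delta> \<Delta> (bas (a, b))))) =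
    L (\<lambda>((x, y), (x', y')). L F (\<pi> (bas (x, x'))) * L G (\<pi> (bas (y, y')))) (tmap \<Delta> \<Delta> (bas (a, b)))"
    unfolding lin_ext_tmap[of _ \<pi>] L_tens_mult lin_ext_middle_swap by (simp add: case_prod_unfold)
  ultimately show ?thesis by (simp add: lin_ext_tmap[where w = "bas (a, b)"])
qed

text \<open>
  Here the commutativity of the target algebra enters, to exchange \<open>F(b')\<close> and \<open>G(a'')\<close>.
\<close>

lemma L_tens_coprod:
  "L (\<lambda>((x, y), (x', y')). (F x * F x') * (G y * G y')) (tens (\<Delta> (bas a)) (\<Delta> (bas b)))
    = conv F G a * conv F G b"
proof -
  have "(\<lambda>((x, y), (x', y')). (F x * F x') * (G y * G y'))
      = (\<lambda>(p, q). (\<lambda>(x, y). F x * G y) p * (\<lambda>(x, y). F x * G y) q)"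
    by (auto simp: fun_eq_iff ac_simps)
  then show ?thesis by (simp only: L_tens_mult conv_def)
qed

lemma multiplicative_conv:
  assumes F: "multiplicative F" and G: "multiplicative G"
  shows "multiplicative (conv F G)"
  unfolding multiplicative_def
proof (intro conjI ballI, unfold split_paired_all, unfold prod.case)
  show "conv F G e = 1" using F G by (simp add: conv_e multiplicative_def)
  fix a b assume ab: "(a, b) \<in> idx HH"
  have "L (conv F G) (\<pi> (bas (a, b))) = L (\<lambda>(x, y). F x * G y) (\<Delta> (\<pi> (bas (a, b))))"
    using ab by (intro L_conv prod_in_H) simp
  also have "\<dots> = L (\<lambda>((x, y), (x', y')). L F (\<pi> (bas (x, x'))) * L G (\<pi> (bas (y, y'))))
      (tens (\<Delta> (bas a)) (\<Delta> (bas b)))"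
    by (rule L_coprod_prod[OF ab])
  also have "\<dots> = L (\<lambda>((x, y), (x', y')). (F x * F x') * (G y * G y'))
      (tens (\<Delta> (bas a)) (\<Delta> (bas b)))"
    using coprod_keys_generic[OF ab]
    by (intro lin_ext_cong) (auto simp: keys_tens multiplicativeD[OF F] multiplicativeD[OF G])
  also have "\<dots> = conv F G a * conv F G b" by (rule L_tens_coprod)
  finally show "L (conv F G) (\<pi> (bas (a, b))) = conv F G a * conv F G b" .
qed

lemma L_counit_prod:
  assumes ab: "(a, b) \<in> idx HH"
  shows "L counit_fun (\<pi> (bas (a, b))) = counit_fun a * counit_fun b"
proof -
  have ab': "a \<in> idx H" "b \<in> idx H" using ab by (auto simp: in_HH_iff)
  have "tens (bas ()) (\<epsilon> (\<pi> (bas (a, b)))) = tmap \<epsilon> \<epsilon> (bas (a, b))"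
    using counit_prod[of "bas (a, b)"] ab by simp
  then have "Poly_Mapping.lookup (tens (bas ()) (\<epsilon> (\<pi> (bas (a, b))))) ((), ())
      = Poly_Mapping.lookup (tmap \<epsilon> \<epsilon> (bas (a, b))) ((), ())" by simp
  then have "Poly_Mapping.lookup (\<pi> (bas (a, b))) e = (if a = e \<and> b = e then 1 else 0)"
    using ab ab' prod_in_H[of "bas (a, b)"]
    by (auto simp: counit_empty tmap_def scal.lin_ext_single lookup_single when_def)
  then show ?thesis by (auto simp: L_counit_fun counit_fun_def)
qed

lemma multiplicative_counit: "multiplicative counit_fun"
  by (auto simp: multiplicative_def L_counit_prod) (simp add: counit_fun_def)

text \<open>
  By triangularity and \<open>G(\<emptyset>) = 1\<close>, the equation \<open>F * G = \<epsilon>\<close> at \<open>a\<close> reads \<open>F(a) = \<epsilon>(a) - \<Sum> F(a') G(a'')\<close>, where the sum is over the terms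
  with \<open>deg a' < deg a\<close>: a recursive definition of \<open>F\<close>.
\<close>

lemma left_inverse_exists:
  assumes "G e = 1"
  shows "\<exists>F. \<forall>a\<in>idx H. conv F G a = counit_fun a"
proof -
  define step where "step F a = counit_fun a
    - L (\<lambda>(x, y). if deg x < deg a then F x * G y else 0) (\<Delta> (bas a))" for F a
  define F where "F = wfrec (measure deg) step"
  \<comment> \<open>\<open>step F a\<close> looks at \<open>F\<close> in lower degrees only, so that the cut-off in \<open>wfrec\<close> has no effect.\<close>
  have F: "F a = step F a" for a
  proof -
    have "F a = step (cut F (measure deg) a) a"
      unfolding F_def by (rule wfrec) simp
    also have "\<dots> = step F a"
      by (simp add: step_def cut_def case_prod_unfold cong: if_cong)
    finally show ?thesis .
  qed
  have "conv F G a = counit_fun a" if a: "a \<in> idx H" for a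
    unfolding conv_def by (subst L_coprod_split[OF a]) (simp add: F[of a] step_def assms)
  then show ?thesis by blast
qed

text \<open>
  Convolving the defect of multiplicativity of \<open>F\<close> with \<open>G \<otimes> G\<close> gives the defect of
  \<open>F * G = \<epsilon>\<close>, which is \<open>0\<close>. By triangularity in both arguments, this convolution is the defect itself
  up to terms of lower degree.
\<close>

lemma left_inverse_multiplicative:
  assumes G: "multiplicative G" and inv: "\<And>a. a \<in> idx H \<Longrightarrow> conv F G a = counit_fun a"
  shows "multiplicative F"
proof -
  have Ge: "G e = 1" using G by (simp add: multiplicative_def)
  have Fe: "F e = 1"
    using inv[OF e_in_H] Ge by (simp add: conv_e counit_fun_def)
  define defect where "defect a b = L F (\<pi> (bas (a, b))) - F a * F b" for a b
  have "defect a b = 0" if "(a, b) \<in> idx HH" for a b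
    using that
  proof (induction "deg a + deg b" arbitrary: a b rule: less_induct)
    case less
    note ab = less.prems
    have ab': "a \<in> idx H" "b \<in> idx H" using ab by (auto simp: in_HH_iff)
    let ?T = "tens (\<Delta> (bas a)) (\<Delta> (bas b))"
    have "L (\<lambda>((x, y), (x', y')). defect x x' * (G y * G y')) ?T =
      L (\<lambda>((x, y), (x', y')). L F (\<pi> (bas (x, x'))) * L G (\<pi> (bas (y, y')))) ?T
      - L (\<lambda>((x, y), (x', y')). (F x * F x') * (G y * G y')) ?T"
      unfolding lin_ext_diff[symmetric] using coprod_keys_generic[OF ab]
      by (intro lin_ext_cong)
        (auto simp: keys_tens multiplicativeD[OF G] defect_def left_diff_distrib)
    also have "\<dots> = L (conv F G) (\<pi> (bas (a, b))) - conv F G a * conv F G b"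
      using ab by (simp add: L_coprod_prod[OF ab, symmetric] L_tens_coprod L_conv prod_in_H)
    also have "L (conv F G) (\<pi> (bas (a, b))) = L counit_fun (\<pi> (bas (a, b)))"
      using ab by (intro lin_ext_cong inv vecs_keysD[OF prod_in_H]) simp_all
    also have "\<dots> - conv F G a * conv F G b = 0"
      using ab' by (simp add: inv L_counit_prod[OF ab])
    finally have zero: "L (\<lambda>((x, y), (x', y')). defect x x' * (G y * G y')) ?T = 0" .
    \<comment> \<open>As a left leg of \<open>\<Delta> a\<close>, the element \<open>a\<close> is in generic position with the left legs of \<open>\<Delta> b\<close>.\<close>
    have top: "(a, e) \<in> Poly_Mapping.keys (\<Delta> (bas a))"
      using coprod_counit_coeff_right[OF ab'(1), of a] by (simp add: in_keys_iff)
    \<comment> \<open>The same sum, split first along \<open>\<Delta> a\<close> and then along \<open>\<Delta> b\<close>, with lower terms zero by induction.\<close>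
    let ?K = "\<lambda>x y. L (\<lambda>(x', y'). defect x x' * (G y * G y')) (\<Delta> (bas b))"
    let ?low = "\<lambda>(x, y). if deg x < deg a then ?K x y else 0"
    have "L (\<lambda>((x, y), (x', y')). defect x x' * (G y * G y')) ?T = L (\<lambda>(x, y). ?K x y) (\<Delta> (bas a))"
      by (simp add: lin_ext_tens case_prod_unfold)
    also have "\<dots> = ?K a e + L ?low (\<Delta> (bas a))"
      by (rule L_coprod_split[OF ab'(1)])
    also have "L ?low (\<Delta> (bas a)) = L (\<lambda>_. 0) (\<Delta> (bas a))"
    proof (rule lin_ext_cong)
      fix p assume "p \<in> Poly_Mapping.keys (\<Delta> (bas a))"
      then obtain x y where p: "p = (x, y)" and xy: "(x, y) \<in> Poly_Mapping.keys (\<Delta> (bas a))"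
        by (cases p) simp
      have "defect x x' = 0"
        if "deg x < deg a" and xy': "(x', y') \<in> Poly_Mapping.keys (\<Delta> (bas b))" for x' y'
        using less.hyps[of x x'] that(1) coprod_keys(4)[OF ab'(2) xy'] coprod_keys_generic[OF ab xy xy']
        by simp
      then have "L (\<lambda>(x', y'). defect x x' * (G y * G y')) (\<Delta> (bas b)) = L (\<lambda>_. 0) (\<Delta> (bas b))"
        if "deg x < deg a"
        using that by (intro lin_ext_cong) auto
      then show "?low p = 0"
        by (simp add: p lin_ext_def)
    qed
    also have "?K a e = defect a b +
        L (\<lambda>(x', y'). if deg x' < deg b then defect a x' * (G e * G y') else 0) (\<Delta> (bas b))"
      using L_coprod_split[OF ab'(2), of "\<lambda>x' y'. defect a x' * (G e * G y')"] Ge by simp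
    also have "L (\<lambda>(x', y'). if deg x' < deg b then defect a x' * (G e * G y') else 0) (\<Delta> (bas b))
        = L (\<lambda>_. 0) (\<Delta> (bas b))"
      using less.hyps[of a] coprod_keys_generic(1)[OF ab top] by (intro lin_ext_cong) auto
    finally show ?case using zero by (simp add: lin_ext_def)
  qed
  then show ?thesis using Fe by (auto simp: multiplicative_def defect_def)
qed

section \<open>The group of characters\<close>

lemma vecs_tens_generic_position:
  assumes "u \<in> vecs H" "v \<in> vecs H" "generic_position P H H u v"
  shows "tens u v \<in> vecs HH"
  using assms by (auto simp: vecs_def keys_tens generic_position_def in_HH_iff)

lemma multiplicative_imp_character:
  assumes "multiplicative F"
  shows "restrict (L F) (vecs H) \<in> characters P H \<pi> e scale"
proof -
  have "L F (\<pi> (tens u v)) = L F u * L F v"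
    if "u \<in> vecs H" "v \<in> vecs H" "generic_position P H H u v" for u v
  proof -
    have w: "tens u v \<in> vecs HH" by (rule vecs_tens_generic_position[OF that])
    then have "L F (\<pi> (tens u v)) = L (\<lambda>p. L F (\<pi> (bas p))) (tens u v)" by (rule L_prod)
    also have "\<dots> = L (\<lambda>(a, b). F a * F b) (tens u v)"
      using multiplicativeD[OF assms] vecs_keysD[OF w] by (intro lin_ext_cong) force
    finally show ?thesis by (simp add: L_tens_mult)
  qed
  moreover have "linear_on_vecs H scale (restrict (L F) (vecs H))"
    by (simp add: linear_on_vecs_def lin_ext_add lin_ext_scal vecs_add vecs_scal)
  ultimately show ?thesis
    using assms e_in_H
    by (auto simp: characters_def multiplicative_def prod_in_H vecs_tens_generic_position)
qed

lemma character_imp_multiplicative: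
  assumes "\<phi> \<in> characters P H \<pi> e scale"
  shows "multiplicative (\<lambda>a. \<phi> (bas a))" "\<phi> = restrict (L (\<lambda>a. \<phi> (bas a))) (vecs H)"
proof -
  have lin: "linear_on_vecs H scale \<phi>" and ext: "\<phi> \<in> extensional (vecs H)"
    and e: "\<phi> (bas e) = 1"
    and mult: "\<And>u v. u \<in> vecs H \<Longrightarrow> v \<in> vecs H \<Longrightarrow> generic_position P H H u v
      \<Longrightarrow> \<phi> (\<pi> (tens u v)) = \<phi> u * \<phi> v"
    using assms by (auto simp: characters_def)
  note L = linear_on_vecs_eq_lin_ext[OF lin]
  show "\<phi> = restrict (L (\<lambda>a. \<phi> (bas a))) (vecs H)"
    by (rule extensionalityI[OF ext restrict_extensional]) (simp add: L)
  have "L (\<lambda>a. \<phi> (bas a)) (\<pi> (bas (a, b))) = \<phi> (bas a) * \<phi> (bas b)" if "(a, b) \<in> idx HH" for a b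
  proof -
    have "L (\<lambda>a. \<phi> (bas a)) (\<pi> (bas (a, b))) = \<phi> (\<pi> (bas (a, b)))"
      using that by (simp add: L prod_in_H)
    also have "\<dots> = \<phi> (bas a) * \<phi> (bas b)"
      using mult[of "bas a" "bas b"] that by (simp add: in_HH_iff generic_position_def)
    finally show ?thesis .
  qed
  then show "multiplicative (\<lambda>a. \<phi> (bas a))" using e by (auto simp: multiplicative_def)
qed

lemma characters_eq: "characters P H \<pi> e scale = (\<lambda>F. restrict (L F) (vecs H)) ` {F. multiplicative F}"
  using multiplicative_imp_character character_imp_multiplicative by blast

lemma restrict_L_cong:
  "(\<And>a. a \<in> idx H \<Longrightarrow> F a = G a) \<Longrightarrow> restrict (L F) (vecs H) = restrict (L G) (vecs H)"
  by (intro restrict_ext lin_ext_cong) (auto dest: vecs_keysD)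

lemma convolution_eq:
  "convolution H \<Delta> scale (restrict (L F) (vecs H)) (restrict (L G) (vecs H))
    = restrict (L (conv F G)) (vecs H)"
  unfolding convolution_def
proof (rule restrict_ext)
  fix h :: "'h \<Rightarrow>\<^sub>0 'k" assume h: "h \<in> vecs H"
  show "L (\<lambda>(a, b). restrict (L F) (vecs H) (bas a) * restrict (L G) (vecs H) (bas b)) (\<Delta> h)
      = L (conv F G) h"
    unfolding L_conv[OF h] using vecs_keysD[OF coprod_in_HH[OF h]]
    by (intro lin_ext_cong) (auto simp: in_HH_iff)
qed

lemma group_char_group: "group (char_group P H \<pi> \<Delta> e scale)" (is "group ?G")
proof (rule groupI)
  have carrier: "carrier ?G = (\<lambda>F. restrict (L F) (vecs H)) ` {F. multiplicative F}"
    by (simp add: char_group_def characters_eq)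
  have mult: "restrict (L F) (vecs H) \<otimes>\<^bsub>?G\<^esub> restrict (L G) (vecs H) = restrict (L (conv F G)) (vecs H)" for F G
    by (simp add: char_group_def convolution_eq)
  have one: "\<one>\<^bsub>?G\<^esub> = restrict (L counit_fun) (vecs H)"
    by (simp add: char_group_def L_counit_fun[abs_def])
  show "\<one>\<^bsub>?G\<^esub> \<in> carrier ?G"
    using multiplicative_counit by (auto simp: carrier one)
  fix x assume "x \<in> carrier ?G"
  then obtain F where F: "multiplicative F" and x: "x = restrict (L F) (vecs H)"
    by (auto simp: carrier)
  show "\<one>\<^bsub>?G\<^esub> \<otimes>\<^bsub>?G\<^esub> x = x"
    unfolding one x mult by (rule restrict_L_cong) (rule conv_counit_left)
  obtain F' where F': "\<And>a. a \<in> idx H \<Longrightarrow> conv F' F a = counit_fun a"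
    using left_inverse_exists multiplicative_e[OF F] by blast
  then have "restrict (L F') (vecs H) \<in> carrier ?G"
    using left_inverse_multiplicative[OF F] by (auto simp: carrier)
  moreover have "restrict (L F') (vecs H) \<otimes>\<^bsub>?G\<^esub> x = \<one>\<^bsub>?G\<^esub>"
    unfolding one x mult by (rule restrict_L_cong) (rule F')
  ultimately show "\<exists>y\<in>carrier ?G. y \<otimes>\<^bsub>?G\<^esub> x = \<one>\<^bsub>?G\<^esub>" by blast
  fix y assume "y \<in> carrier ?G"
  then obtain G where G: "multiplicative G" and y: "y = restrict (L G) (vecs H)"
    by (auto simp: carrier)
  show "x \<otimes>\<^bsub>?G\<^esub> y \<in> carrier ?G"
    using multiplicative_conv[OF F G] by (auto simp: carrier x y mult)
  fix z assume "z \<in> carrier ?G"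
  then obtain K where z: "z = restrict (L K) (vecs H)" by (auto simp: carrier)
  show "x \<otimes>\<^bsub>?G\<^esub> y \<otimes>\<^bsub>?G\<^esub> z = x \<otimes>\<^bsub>?G\<^esub> (y \<otimes>\<^bsub>?G\<^esub> z)"
    unfolding x y z mult by (rule restrict_L_cong) (rule conv_assoc)
qed

end

section \<open>Functoriality\<close>

lemma alg_homD:
  assumes "alg_hom sB sC f"
  shows "f (x + y) = f x + f y" "f (sB c x) = sC c (f x)" "f (x * y) = f x * f y" "f 1 = 1"
proof -
  have hom: "module_hom sB sC f"
    using assms by (simp add: alg_hom_def linear_iff_module_hom)
  show "f (x + y) = f x + f y" "f (sB c x) = sC c (f x)"
    using module_hom.add[OF hom] module_hom.scale[OF hom] by auto
  show "f (x * y) = f x * f y" "f 1 = 1"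
    using assms by (auto simp: alg_hom_def)
qed

lemma alg_hom_lin_ext:
  assumes "alg_hom sB sC f"
  shows "f (lin_ext sB F v) = lin_ext sC (f \<circ> F) v"
proof -
  have "module_hom sB sC f"
    using assms by (simp add: alg_hom_def linear_iff_module_hom)
  then show ?thesis
    using assms by (simp add: lin_ext_def module_hom.sum alg_homD)
qed

lemma char_map_character:
  assumes f: "alg_hom sB sC f" and \<phi>: "\<phi> \<in> characters P H \<pi> e sB"
    and H: "e \<in> idx H" "\<And>w. w \<in> vecs (gen_tensor P H H) \<Longrightarrow> \<pi> w \<in> vecs H"
  shows "char_map H f \<phi> \<in> characters P H \<pi> e sC"
proof -
  have tens: "tens u v \<in> vecs (gen_tensor P H H)"
    if "u \<in> vecs H" "v \<in> vecs H" "generic_position P H H u v" for u v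
    using that by (auto simp: vecs_def keys_tens generic_position_def gen_tensor_def)
  have val: "char_map H f \<phi> h = f (\<phi> h)" if "h \<in> vecs H" for h
    using that by (simp add: char_map_def compose_def)
  have "char_map H f \<phi> \<in> extensional (vecs H)"
    by (simp add: char_map_def)
  moreover have "linear_on_vecs H sC (char_map H f \<phi>)"
    using \<phi> by (simp add: linear_on_vecs_def characters_def val vecs_add vecs_scal alg_homD[OF f])
  moreover have "char_map H f \<phi> (bas e) = 1"
    using \<phi> H(1) by (simp add: val characters_def alg_homD[OF f])
  moreover have "char_map H f \<phi> (\<pi> (tens u v)) = char_map H f \<phi> u * char_map H f \<phi> v"
    if "u \<in> vecs H" "v \<in> vecs H" "generic_position P H H u v" for u v
    using \<phi> that H(2)[OF tens[OF that]] by (simp add: val characters_def alg_homD[OF f])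
  ultimately show ?thesis by (auto simp: characters_def)
qed

lemma char_map_convolution:
  assumes f: "alg_hom sB sC f" and \<Delta>: "\<And>h. h \<in> vecs H \<Longrightarrow> \<Delta> h \<in> vecs (gen_tensor P H H)"
  shows "char_map H f (convolution H \<Delta> sB \<phi> \<psi>)
    = convolution H \<Delta> sC (char_map H f \<phi>) (char_map H f \<psi>)"
proof (rule ext)
  fix h
  have mult: "f (x * y) = f x * f y" for x y using f by (auto simp: alg_hom_def)
  have "lin_ext sC (f \<circ> (\<lambda>(a, b). \<phi> (bas a) * \<psi> (bas b))) (\<Delta> h) =
    lin_ext sC (\<lambda>(a, b). char_map H f \<phi> (bas a) * char_map H f \<psi> (bas b)) (\<Delta> h)" if "h \<in> vecs H"
    unfolding lin_ext_def using \<Delta>[OF that]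
    by (intro sum.cong refl) (auto simp: vecs_def gen_tensor_def char_map_def compose_def mult)
  then show "char_map H f (convolution H \<Delta> sB \<phi> \<psi>) h
    = convolution H \<Delta> sC (char_map H f \<phi>) (char_map H f \<psi>) h"
    by (simp add: convolution_def char_map_def compose_def alg_hom_lin_ext[OF f])
qed

theorem proposition13:
  fixes X :: "'x set" and P :: "'x set set"
    and H :: "('h, 'x) gen_obj"
    and \<pi> :: "('h \<times> 'h \<Rightarrow>\<^sub>0 'k::field_char_0) \<Rightarrow> ('h \<Rightarrow>\<^sub>0 'k)"
    and \<eta> :: "(unit \<Rightarrow>\<^sub>0 'k) \<Rightarrow> ('h \<Rightarrow>\<^sub>0 'k)"
    and \<Delta> :: "('h \<Rightarrow>\<^sub>0 'k) \<Rightarrow> ('h \<times> 'h \<Rightarrow>\<^sub>0 'k)"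
    and \<epsilon> :: "('h \<Rightarrow>\<^sub>0 'k) \<Rightarrow> (unit \<Rightarrow>\<^sub>0 'k)"
    and deg :: "'h \<Rightarrow> nat" and e :: 'h
    and sB :: "'k \<Rightarrow> 'b::{comm_ring, comm_monoid_mult} \<Rightarrow> 'b"
    and sC :: "'k \<Rightarrow> 'c::{comm_ring, comm_monoid_mult} \<Rightarrow> 'c"
    and sD :: "'k \<Rightarrow> 'd::{comm_ring, comm_monoid_mult} \<Rightarrow> 'd"
  assumes "countable X" and "partition_on X P"
    and "standard_generic_bialgebra P H \<pi> \<eta> \<Delta> \<epsilon> deg e"
    and "comm_algebra sB" and "comm_algebra sC" and "comm_algebra sD"
  shows "group (char_group P H \<pi> \<Delta> e sB) \<and>
    (\<forall>f. alg_hom sB sC f \<longrightarrow>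
       char_map H f \<in> hom (char_group P H \<pi> \<Delta> e sB) (char_group P H \<pi> \<Delta> e sC)) \<and>
    (\<forall>\<phi> \<in> carrier (char_group P H \<pi> \<Delta> e sB). char_map H id \<phi> = \<phi>) \<and>
    (\<forall>f g. alg_hom sB sC f \<longrightarrow> alg_hom sC sD g \<longrightarrow>
       (\<forall>\<phi> \<in> carrier (char_group P H \<pi> \<Delta> e sB).
          char_map H (g \<circ> f) \<phi> = char_map H g (char_map H f \<phi>)))"
proof -
  interpret B: characters_of_standard_bialgebra P H \<pi> \<eta> \<Delta> \<epsilon> deg e sB
    using assms by (simp add: characters_of_standard_bialgebra_def
        characters_of_standard_bialgebra_axioms_def partition_on_def)
  have "char_map H f \<in> hom (char_group P H \<pi> \<Delta> e sB) (char_group P H \<pi> \<Delta> e sC)"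
    if f: "alg_hom sB sC f" for f
    unfolding hom_def char_group_def
    by (auto intro!: char_map_character[OF f _ B.e_in_H B.prod_in_H]
        char_map_convolution[OF f, of H \<Delta> P] B.coprod_in_HH)
  moreover have "char_map H id \<phi> = \<phi>" if "\<phi> \<in> carrier (char_group P H \<pi> \<Delta> e sB)" for \<phi>
    using that by (auto simp: char_group_def characters_def char_map_def compose_def extensional_def)
  moreover have "char_map H (g \<circ> f) \<phi> = char_map H g (char_map H f \<phi>)"
    for f :: "'b \<Rightarrow> 'c" and g :: "'c \<Rightarrow> 'd" and \<phi> :: "('h \<Rightarrow>\<^sub>0 'k) \<Rightarrow> 'b"
    by (auto simp: char_map_def compose_def)
  ultimately show ?thesis
    using B.group_char_group by simp
qed

end
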